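(* Let $F\colon\mathbb{R}^d\to\mathbb{R}^d$ be $L$-Lipschitz with $L>0$, and suppose there is a point $z^*\in\mathbb{R}^d$ (a weak Minty solution) such that $$\langle F(z),z-z^*\rangle\ge-\frac\rho2\|F(z)\|^2\qquad\text{for all }z\in\mathbb{R}^d,$$ with $\rho<\frac1L$. Let $\phi>1$ be such that $\delta:=\frac{2-\phi}{\phi L}-\rho>0$ and $\phi<2$. Let $(z^k)$ and $(\bar z^k)$ be the iterates generated by unconstrained GRAAL with parameter $\phi$ and step size $\alpha=\frac{2-\phi}{L}$. Then for all $k\ge1$, $$\min_{i=1,\dots,k}\|F(z^i)\|^2\le\frac{L\phi}{k(2-\phi)(\phi-1)\delta}\left(\|\bar z^1-z^*\|^2+\frac2\phi\|z^1-z^0\|^2\right).$$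
   Context: $\|\cdot\|$ is the Euclidean norm. Unconstrained GRAAL (the case $C=\mathbb{R}^d$, so the projection is the identity) with parameter $\phi$ and constant step size $\alpha$ starts from $\bar z^{-1}=z^0\in\mathbb{R}^d$ and iterates, for $k\ge0$, $$\bar z^k=\frac{\phi-1}{\phi}z^k+\frac1\phi\bar z^{k-1},\qquad z^{k+1}=\bar z^k-\alpha F(z^k).$$ In particular $\bar z^0=z^0$. *)

theory Defs
  imports "HOL-Analysis.Analysis"
begin

definition weak_minty_solution :: "('a::real_inner \<Rightarrow> 'a) \<Rightarrow> real \<Rightarrow> 'a \<Rightarrow> bool" where
  "weak_minty_solution F \<rho> zs \<longleftrightarrow>
     (\<forall>z. F z \<bullet> (z - zs) \<ge> - (\<rho> / 2) * (norm (F z))\<^sup>2)"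

text \<open>The averaged sequence \<open>zb\<close> starts at index \<open>-1\<close>, so it is indexed by integers; its values
  below \<open>-1\<close> are unconstrained and irrelevant.\<close>

definition graal_iterates ::
  "('a::real_vector \<Rightarrow> 'a) \<Rightarrow> real \<Rightarrow> real \<Rightarrow> (nat \<Rightarrow> 'a) \<Rightarrow> (int \<Rightarrow> 'a) \<Rightarrow> bool" where
  "graal_iterates F \<phi> \<alpha> z zb \<longleftrightarrow>
     zb (- 1) = z 0 \<and>
     (\<forall>k::nat. zb (int k) = ((\<phi> - 1) / \<phi>) *\<^sub>R z k + (1 / \<phi>) *\<^sub>R zb (int k - 1) \<and>
               z (k + 1) = zb (int k) - \<alpha> *\<^sub>R F (z k))"

end

theory Submission
  imports Defs
begin

text \<open>
  Write \<open>v = \<alpha> F(z\<^sub>k)\<close> and \<open>u = \<alpha> F(z\<^sub>k\<^sub>-\<^sub>1)\<close>. The averaged iterate satisfies \<open>zb\<^sub>k = z\<^sub>k + u/\<phi>\<close> and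
  performs the step \<open>zb\<^sub>k\<^sub>+\<^sub>1 = zb\<^sub>k - (1 - 1/\<phi>) v\<close>. Expanding \<open>\<parallel>zb\<^sub>k\<^sub>+\<^sub>1 - zs\<parallel>\<^sup>2\<close> and using the weak Minty
  inequality at \<open>z\<^sub>k\<close> leaves the error \<open>\<parallel>v\<parallel>\<^sup>2 - 2\<langle>u,v\<rangle>/\<phi>\<close>. Since \<open>\<alpha>L = 2 - \<phi>\<close>, the Lipschitz bound
  \<open>\<parallel>v - u\<parallel> \<le> (2 - \<phi>) \<parallel>z\<^sub>k - z\<^sub>k\<^sub>-\<^sub>1\<parallel>\<close> and \<open>z\<^sub>k\<^sub>+\<^sub>1 - z\<^sub>k = u/\<phi> - v\<close> show that this error is absorbed by the
  decrease of \<open>(2 - \<phi>)/(\<phi> - 1) \<parallel>z\<^sub>k - z\<^sub>k\<^sub>-\<^sub>1\<parallel>\<^sup>2\<close>, up to a perfect square. Hence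
  \<open>\<phi>/(\<phi> - 1) \<parallel>zb\<^sub>k - zs\<parallel>\<^sup>2 + (2 - \<phi>)/(\<phi> - 1) \<parallel>z\<^sub>k - z\<^sub>k\<^sub>-\<^sub>1\<parallel>\<^sup>2\<close> decreases by at least \<open>\<alpha>\<delta> \<parallel>F(z\<^sub>k)\<parallel>\<^sup>2\<close>.
\<close>

text \<open>Here \<open>e\<close> plays the role of the last difference of iterates and
  \<open>u /\<^sub>R \<phi> - v\<close> that of the next. Squaring \<open>lip\<close> and dividing
  by (\<phi> - 1)(2 - \<phi>) produces exactly the right-hand side.\<close>

lemma graal_error_bound:
  fixes u v e :: "'a::real_inner" and \<phi> :: real
  assumes "1 < \<phi>" "\<phi> < 2" and lip: "norm (v - u) \<le> (2 - \<phi>) * norm e"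
  shows "(norm v)\<^sup>2 - 2 / \<phi> * (u \<bullet> v) + (2 - \<phi>) / (\<phi> - 1) * (norm (u /\<^sub>R \<phi> - v))\<^sup>2
           \<le> (2 - \<phi>) / (\<phi> - 1) * (norm e)\<^sup>2"
proof -
  define x y w where "x = u \<bullet> u" and "y = u \<bullet> v" and "w = v \<bullet> v"
  note inner_simps = power2_norm_eq_inner inner_diff_left inner_diff_right
  have pos: "\<phi> > 0" "\<phi> - 1 > 0" "2 - \<phi> > 0" using assms by auto
  have "(norm (v - u))\<^sup>2 \<le> ((2 - \<phi>) * norm e)\<^sup>2"
    using lip by (intro power_mono) auto
  then have "(norm (v - u))\<^sup>2 / ((\<phi> - 1) * (2 - \<phi>)) \<le> ((2 - \<phi>) * norm e)\<^sup>2 / ((\<phi> - 1) * (2 - \<phi>))"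
    using pos by (intro divide_right_mono) auto
  also have "\<dots> = (2 - \<phi>) / (\<phi> - 1) * (norm e)\<^sup>2"
    using pos by (simp add: power2_eq_square)
  finally have "(norm (v - u))\<^sup>2 / ((\<phi> - 1) * (2 - \<phi>)) \<le> (2 - \<phi>) / (\<phi> - 1) * (norm e)\<^sup>2" .
  moreover have "(norm (v - u))\<^sup>2 = w - 2 * y + x"
    unfolding x_def y_def w_def inner_simps by (simp add: inner_commute)
  moreover have "(norm (u /\<^sub>R \<phi> - v))\<^sup>2 = x / \<phi>\<^sup>2 - 2 * y / \<phi> + w"
    unfolding x_def y_def w_def inner_simps using pos
    by (simp add: inner_commute[of v u] power2_eq_square field_simps)
  \<comment> \<open>The slack is a complete square: it equals the squared norm of
    \<open>v - (2 / \<phi>) *\<^sub>R u\<close> over 2 - \<phi>, hence is nonnegative.\<close>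
  moreover have "(w - 2 * y + x) / ((\<phi> - 1) * (2 - \<phi>))
      - (w - 2 / \<phi> * y + (2 - \<phi>) / (\<phi> - 1) * (x / \<phi>\<^sup>2 - 2 * y / \<phi> + w))
      = (w - 4 * y / \<phi> + 4 * x / \<phi>\<^sup>2) / (2 - \<phi>)"
  proof -
    have "\<phi> \<noteq> 0" "\<phi> - 1 \<noteq> 0" "2 - \<phi> \<noteq> 0" using pos by auto
    then show ?thesis by (simp add: divide_simps) algebra
  qed
  moreover have "(norm (v - (2 / \<phi>) *\<^sub>R u))\<^sup>2 = w - 4 * y / \<phi> + 4 * x / \<phi>\<^sup>2"
    unfolding x_def y_def w_def inner_simps using pos
    by (simp add: inner_commute[of v u] power2_eq_square field_simps)
  moreover have "(norm (v - (2 / \<phi>) *\<^sub>R u))\<^sup>2 / (2 - \<phi>) \<ge> 0"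
    using pos by simp
  ultimately show ?thesis
    by (simp add: y_def w_def power2_norm_eq_inner[of v])
qed

lemma graal_averaged_step:
  fixes F :: "'a::real_inner \<Rightarrow> 'a"
  assumes "\<phi> > 1" and "graal_iterates F \<phi> \<alpha> z zb"
  shows "zb (int (k + 1)) = z (k + 1) + (\<alpha> / \<phi>) *\<^sub>R F (z k)"
    and "zb (int (k + 1)) = zb (int k) - ((\<phi> - 1) / \<phi> * \<alpha>) *\<^sub>R F (z k)"
    and "z (k + 1) = zb (int k) - \<alpha> *\<^sub>R F (z k)"
proof -
  show z: "z (k + 1) = zb (int k) - \<alpha> *\<^sub>R F (z k)"
    using assms(2) by (simp add: graal_iterates_def)
  have "zb (int (k + 1)) = ((\<phi> - 1) / \<phi>) *\<^sub>R z (k + 1) + (1 / \<phi>) *\<^sub>R zb (int (k + 1) - 1)"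
    using assms(2) unfolding graal_iterates_def by blast
  then have zb: "zb (int (k + 1)) = ((\<phi> - 1) / \<phi>) *\<^sub>R z (k + 1) + (1 / \<phi>) *\<^sub>R zb (int k)"
    by simp
  have c: "(\<phi> - 1) / \<phi> = 1 - 1 / \<phi>" using assms(1) by (simp add: field_simps)
  show "zb (int (k + 1)) = z (k + 1) + (\<alpha> / \<phi>) *\<^sub>R F (z k)"
    unfolding zb z c by (simp add: algebra_simps)
  show "zb (int (k + 1)) = zb (int k) - ((\<phi> - 1) / \<phi> * \<alpha>) *\<^sub>R F (z k)"
    unfolding zb z c by (simp add: algebra_simps)
qed

text \<open>Indices are shifted by one because writing \<open>zb\<close> through the previous value
  of \<open>F\<close> is possible only from index 1 on.\<close>

lemma graal_descent:
  fixes F :: "'a::real_inner \<Rightarrow> 'a"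
  assumes L: "L > 0" and lip: "L-lipschitz_on UNIV F" and minty: "weak_minty_solution F \<rho> zs"
    and phi: "1 < \<phi>" "\<phi> < 2" and alpha: "\<alpha> = (2 - \<phi>) / L"
    and it: "graal_iterates F \<phi> \<alpha> z zb"
  shows "\<phi> / (\<phi> - 1) * (norm (zb (int (k + 2)) - zs))\<^sup>2
           + (2 - \<phi>) / (\<phi> - 1) * (norm (z (k + 2) - z (k + 1)))\<^sup>2
           + \<alpha> * (\<alpha> / \<phi> - \<rho>) * (norm (F (z (k + 1))))\<^sup>2
         \<le> \<phi> / (\<phi> - 1) * (norm (zb (int (k + 1)) - zs))\<^sup>2
           + (2 - \<phi>) / (\<phi> - 1) * (norm (z (k + 1) - z k))\<^sup>2"
proof -
  define u v where "u = \<alpha> *\<^sub>R F (z k)" and "v = \<alpha> *\<^sub>R F (z (k + 1))"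
  define b where "b = zb (int (k + 1))"
  have alpha_pos: "\<alpha> > 0" using L phi alpha by simp
  have b: "b = z (k + 1) + u /\<^sub>R \<phi>"
    using graal_averaged_step(1)[OF phi(1) it, of k] by (simp add: b_def u_def divide_inverse_commute)
  have b': "zb (int (k + 2)) = b - ((\<phi> - 1) / \<phi>) *\<^sub>R v"
    using graal_averaged_step(2)[OF phi(1) it, of "k + 1"] by (simp add: b_def v_def add.commute)
  have "z (k + 2) = b - v"
    using graal_averaged_step(3)[OF phi(1) it, of "k + 1"] by (simp add: b_def v_def add.commute)
  then have d: "z (k + 2) - z (k + 1) = u /\<^sub>R \<phi> - v" by (simp add: b)
  have "norm (v - u) = \<alpha> * norm (F (z (k + 1)) - F (z k))"
    using alpha_pos by (simp add: u_def v_def flip: scaleR_diff_right)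
  also have "\<dots> \<le> \<alpha> * (L * norm (z (k + 1) - z k))"
    using lipschitz_onD[OF lip, of "z (k + 1)" "z k"] alpha_pos
    by (intro mult_left_mono) (auto simp: dist_norm)
  also have "\<dots> = (2 - \<phi>) * norm (z (k + 1) - z k)"
    using L by (simp add: alpha)
  finally have error: "(norm v)\<^sup>2 - 2 / \<phi> * (u \<bullet> v)
      + (2 - \<phi>) / (\<phi> - 1) * (norm (z (k + 2) - z (k + 1)))\<^sup>2
      \<le> (2 - \<phi>) / (\<phi> - 1) * (norm (z (k + 1) - z k))\<^sup>2"
    unfolding d by (rule graal_error_bound[OF phi])
  have expand: "\<phi> / (\<phi> - 1) * (norm (zb (int (k + 2)) - zs))\<^sup>2
      = \<phi> / (\<phi> - 1) * (norm (b - zs))\<^sup>2 - 2 * (v \<bullet> (b - zs)) + (1 - 1 / \<phi>) * (norm v)\<^sup>2"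
  proof -
    \<comment> \<open>The weight \<phi> / (\<phi> - 1) is the reciprocal of the step factor
      \<open>c\<close>, so the cross term gets coefficient exactly 2.\<close>
    define c where "c = (\<phi> - 1) / \<phi>"
    have "c \<noteq> 0" and c: "\<phi> / (\<phi> - 1) = 1 / c" "1 - 1 / \<phi> = c"
      using phi by (auto simp: c_def field_simps)
    have "(norm (zb (int (k + 2)) - zs))\<^sup>2 = (norm ((b - zs) - c *\<^sub>R v))\<^sup>2"
      unfolding b' c_def by (simp add: algebra_simps)
    also have "\<dots> = (norm (b - zs))\<^sup>2 - 2 * c * (v \<bullet> (b - zs)) + c\<^sup>2 * (norm v)\<^sup>2"
      unfolding power2_norm_eq_inner inner_diff_left[of "b - zs"] inner_diff_right[of _ "b - zs"]
      by (simp add: inner_commute power2_eq_square)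
    finally show ?thesis
      unfolding c using \<open>c \<noteq> 0\<close> by (simp add: field_simps power2_eq_square)
  qed
  \<comment> \<open>Substituting \<open>b\<close> separates the part controlled by weak Minty from
    the cross term in \<open>error\<close>.\<close>
  have inner: "2 * (v \<bullet> (b - zs))
      = 2 * (\<alpha> * (F (z (k + 1)) \<bullet> (z (k + 1) - zs))) + 2 / \<phi> * (u \<bullet> v)"
    by (simp add: b v_def inner_add_right inner_diff_right inner_commute algebra_simps divide_inverse)
  have "F (z (k + 1)) \<bullet> (z (k + 1) - zs) \<ge> - (\<rho> / 2) * (norm (F (z (k + 1))))\<^sup>2"
    using minty unfolding weak_minty_solution_def by blast
  then have "\<alpha> * (F (z (k + 1)) \<bullet> (z (k + 1) - zs))
      \<ge> \<alpha> * (- (\<rho> / 2) * (norm (F (z (k + 1))))\<^sup>2)"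
    using alpha_pos by (intro mult_left_mono) auto
  then have wm: "2 * (\<alpha> * (F (z (k + 1)) \<bullet> (z (k + 1) - zs)))
      \<ge> - (\<alpha> * \<rho> * (norm (F (z (k + 1))))\<^sup>2)"
    by simp
  have "(norm v)\<^sup>2 = \<alpha>\<^sup>2 * (norm (F (z (k + 1))))\<^sup>2"
    by (simp add: v_def power_mult_distrib)
  \<comment> \<open>\<open>expand\<close> contributes only 1 - 1 / \<phi> of the full square of
    \<open>v\<close> in \<open>error\<close>; the spare fraction 1 / \<phi> pays for the weak Minty
    deficit.\<close>
  then have "\<alpha> * (\<alpha> / \<phi> - \<rho>) * (norm (F (z (k + 1))))\<^sup>2
      = (norm v)\<^sup>2 / \<phi> - \<alpha> * \<rho> * (norm (F (z (k + 1))))\<^sup>2"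
    by (simp add: algebra_simps power2_eq_square)
  moreover have "(1 - 1 / \<phi>) * (norm v)\<^sup>2 = (norm v)\<^sup>2 - (norm v)\<^sup>2 / \<phi>"
    by (simp add: left_diff_distrib)
  ultimately show ?thesis
    using error expand inner wm unfolding b_def by linarith
qed

lemma min_le_average:
  fixes f :: "nat \<Rightarrow> real"
  assumes "k \<ge> 1" and "(\<Sum>i=1..k. f i) \<le> B"
  shows "(MIN i\<in>{1..k}. f i) \<le> B / real k"
proof -
  have "real k * (MIN i\<in>{1..k}. f i) = (\<Sum>i=1..k. MIN i\<in>{1..k}. f i)" by simp
  also have "\<dots> \<le> (\<Sum>i=1..k. f i)" by (intro sum_mono Min_le) auto
  finally show ?thesis using assms by (simp add: field_simps)
qed

theorem theorem7:
  fixes F :: "real ^ 'd \<Rightarrow> real ^ 'd"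
    and L \<rho> \<phi> \<delta> :: real
    and zs :: "real ^ 'd"
    and z :: "nat \<Rightarrow> real ^ 'd"
    and zb :: "int \<Rightarrow> real ^ 'd"
    and k :: nat
  assumes "L > 0"
    and "L-lipschitz_on UNIV F"
    and "weak_minty_solution F \<rho> zs"
    and "\<rho> < 1 / L"
    and "\<phi> > 1"
    and "\<phi> < 2"
    and "\<delta> = (2 - \<phi>) / (\<phi> * L) - \<rho>"
    and "\<delta> > 0"
    and "graal_iterates F \<phi> ((2 - \<phi>) / L) z zb"
    and "k \<ge> 1"
  shows "(MIN i\<in>{1..k}. (norm (F (z i)))\<^sup>2)
           \<le> L * \<phi> / (real k * (2 - \<phi>) * (\<phi> - 1) * \<delta>)
             * ((norm (zb 1 - zs))\<^sup>2 + 2 / \<phi> * (norm (z 1 - z 0))\<^sup>2)"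
proof -
  define \<alpha> where "\<alpha> = (2 - \<phi>) / L"
  define V where "V n = \<phi> / (\<phi> - 1) * (norm (zb (int (n + 1)) - zs))\<^sup>2
    + (2 - \<phi>) / (\<phi> - 1) * (norm (z (n + 1) - z n))\<^sup>2" for n
  let ?N = "\<lambda>i. (norm (F (z i)))\<^sup>2"
  have c: "\<alpha> * \<delta> > 0" and \<delta>: "\<delta> = \<alpha> / \<phi> - \<rho>"
    using assms by (simp_all add: \<alpha>_def mult.commute)
  have step: "V (Suc n) + \<alpha> * \<delta> * ?N (Suc n) \<le> V n" for n
    using graal_descent[OF assms(1-3,5,6) \<alpha>_def assms(9)[folded \<alpha>_def], of n]
    by (simp add: V_def \<delta>)
  have "\<alpha> * \<delta> * (\<Sum>i=1..n. ?N i) + V n \<le> V 0" for n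
  proof (induction n)
    case (Suc n)
    then show ?case using step[of n] by (simp add: distrib_left)
  qed simp
  \<comment> \<open>After telescoping, the nonnegative \<open>V k\<close> is dropped.\<close>
  from this[of k] have "\<alpha> * \<delta> * (\<Sum>i=1..k. ?N i) \<le> V 0"
    using assms(5,6) by (smt (verit) V_def divide_nonneg_pos mult_nonneg_nonneg zero_le_power2)
  also have "\<dots> \<le> \<phi> / (\<phi> - 1) * ((norm (zb 1 - zs))\<^sup>2 + 2 / \<phi> * (norm (z 1 - z 0))\<^sup>2)"
  proof -
    \<comment> \<open>Enlarging 2 - \<phi> to 2 yields the weight 2 / \<phi> of the stated bound
      once \<phi> / (\<phi> - 1) is factored out.\<close>
    have "(2 - \<phi>) / (\<phi> - 1) * (norm (z 1 - z 0))\<^sup>2 \<le> 2 / (\<phi> - 1) * (norm (z 1 - z 0))\<^sup>2"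
      using assms(5,6) by (intro mult_right_mono divide_right_mono) auto
    moreover have "\<phi> / (\<phi> - 1) * (2 / \<phi> * (norm (z 1 - z 0))\<^sup>2) = 2 / (\<phi> - 1) * (norm (z 1 - z 0))\<^sup>2"
      using assms(5) by simp
    ultimately show ?thesis by (simp add: V_def distrib_left)
  qed
  finally have "(\<Sum>i=1..k. ?N i)
      \<le> \<phi> / (\<phi> - 1) * ((norm (zb 1 - zs))\<^sup>2 + 2 / \<phi> * (norm (z 1 - z 0))\<^sup>2) / (\<alpha> * \<delta>)"
    unfolding pos_le_divide_eq[OF c] by (simp only: mult.commute)
  from min_le_average[OF assms(10) this] show ?thesis
    by (simp add: \<alpha>_def mult_ac)
qed

end
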